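(* For the binary additive noisy multiple access channel $Y=X_1+X_2+N$, where $X_1,X_2\in\{0,1\}$, addition is ordinary integer addition, and $N$ is uniform on $\{0,1\}$ and independent of $(X_1,X_2)$, the Cover-Leung rate region $\mathcal{CL}$ equals $$\bigcup_{u_1,u_2\in[0,\frac14]}\Bigl\{(R_1,R_2):\ R_1\le\tfrac12h(\phi(2u_1)),\ R_2\le\tfrac12h(\phi(2u_2)),\ R_1+R_2\le h\Bigl(\tfrac{1-f(2u_1,2u_2)}{2}\Bigr)\Bigr\}.$$ Moreover, the entire region $\mathcal{CL}$ is obtained by restricting the auxiliary random variable $T$ in its definition to be binary and uniform on $\{0,1\}$; specifically, it suffices to use the distributions with $\Pr(T=0)=\Pr(T=1)=\frac12$, $\Pr(X_1=0|T=0)=1-\Pr(X_1=0|T=1)=\phi(2u_1)$ and $\Pr(X_2=0|T=0)=1-\Pr(X_2=0|T=1)=\phi(2u_2)$, for $u_1,u_2\in[0,\frac14]$.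
   Context: All logarithms, entropies and mutual informations are to base 2. $h(s)=-s\log s-(1-s)\log(1-s)$ is the binary entropy function on $[0,1]$ (with $0\log0=0$). The function $\phi:[0,1]\to[0,\frac12]$ is $\phi(s)=\frac{1-\sqrt{1-2s}}{2}$ for $0\le s\le\frac12$ and $\phi(s)=\frac{1-\sqrt{2s-1}}{2}$ for $\frac12<s\le1$. For $x,y\in[0,\frac12]$, $f(x,y)=\phi(x)+\phi(y)-2\phi(x)\phi(y)=\frac{1-\sqrt{(1-2x)(1-2y)}}{2}$. For a two-user discrete memoryless multiple access channel $p(y|x_1,x_2)$ with finite alphabets $\mathcal X_1,\mathcal X_2,\mathcal Y$, the Cover-Leung region $\mathcal{CL}$ is the union, over all joint distributions $p(t,x_1,x_2,y)=p(t)p(x_1|t)p(x_2|t)p(y|x_1,x_2)$ with auxiliary random variable $T$ taking at most $\min(|\mathcal X_1||\mathcal X_2|+1,|\mathcal Y|+2)$ values, of the sets of rate pairs $(R_1,R_2)$ with $R_1\le I(X_1;Y|X_2,T)$, $R_2\le I(X_2;Y|X_1,T)$, $R_1+R_2\le I(X_1,X_2;Y)$. Rate pairs are pairs of nonnegative reals. For the channel here $\mathcal X_1=\mathcal X_2=\{0,1\}$, $\mathcal Y=\{0,1,2,3\}$. *)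

theory Defs
  imports "HOL-Probability.Probability"
begin

section \<open>The scalar functions\<close>

text \<open>At the endpoints the convention \<open>0 * log 0 = 0\<close> holds automatically.\<close>

definition binary_entropy :: "real \<Rightarrow> real" where
  "binary_entropy s = - s * log 2 s - (1 - s) * log 2 (1 - s)"

definition phi :: "real \<Rightarrow> real" where
  "phi s = (if s \<le> 1/2 then (1 - sqrt (1 - 2 * s)) / 2 else (1 - sqrt (2 * s - 1)) / 2)"

definition phi_conv :: "real \<Rightarrow> real \<Rightarrow> real" where
  "phi_conv x y = phi x + phi y - 2 * phi x * phi y"

lemma phi_conv_eq:
  assumes "x \<in> {0..1/2}" "y \<in> {0..1/2}"
  shows "phi_conv x y = (1 - sqrt ((1 - 2 * x) * (1 - 2 * y))) / 2"
proof -
  have e: "phi x = (1 - sqrt (1 - 2 * x)) / 2" "phi y = (1 - sqrt (1 - 2 * y)) / 2"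
    using assms by (simp_all add: phi_def)
  show ?thesis
    unfolding phi_conv_def e real_sqrt_mult by (simp add: field_simps)
qed

section \<open>Discrete mutual information\<close>

text \<open>Mutual information in bits of random variables on a discrete probability space, each
  with values in the discrete measurable space on its type.\<close>

definition mutual_info :: "'s pmf \<Rightarrow> ('s \<Rightarrow> 'x) \<Rightarrow> ('s \<Rightarrow> 'y) \<Rightarrow> real" where
  "mutual_info p X Y =
     prob_space.mutual_information (measure_pmf p) 2 (count_space UNIV) (count_space UNIV) X Y"

definition cond_mutual_info ::
  "'s pmf \<Rightarrow> ('s \<Rightarrow> 'x) \<Rightarrow> ('s \<Rightarrow> 'y) \<Rightarrow> ('s \<Rightarrow> 'z) \<Rightarrow> real" where
  "cond_mutual_info p X Y Z =
     prob_space.conditional_mutual_information (measure_pmf p) 2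
       (count_space UNIV) (count_space UNIV) (count_space UNIV) X Y Z"

section \<open>The Cover-Leung region of a two-user multiple access channel\<close>

text \<open>\<open>W x1 x2\<close> is the conditional output distribution \<open>p(y|x1,x2)\<close>; the kernels \<open>p1\<close> and \<open>p2\<close>
  are \<open>p(x1|t)\<close> and \<open>p(x2|t)\<close>.\<close>

definition cl_joint ::
  "('a \<Rightarrow> 'b \<Rightarrow> 'c pmf) \<Rightarrow> nat pmf \<Rightarrow> (nat \<Rightarrow> 'a pmf) \<Rightarrow> (nat \<Rightarrow> 'b pmf)
     \<Rightarrow> (nat \<times> 'a \<times> 'b \<times> 'c) pmf" where
  "cl_joint W pT p1 p2 =
     bind_pmf pT (\<lambda>t. bind_pmf (p1 t) (\<lambda>x1. bind_pmf (p2 t) (\<lambda>x2.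
       bind_pmf (W x1 x2) (\<lambda>y. return_pmf (t, x1, x2, y)))))"

definition cl_rates ::
  "('a \<Rightarrow> 'b \<Rightarrow> 'c pmf) \<Rightarrow> nat pmf \<Rightarrow> (nat \<Rightarrow> 'a pmf) \<Rightarrow> (nat \<Rightarrow> 'b pmf) \<Rightarrow> (real \<times> real) set" where
  "cl_rates W pT p1 p2 =
     (let J = cl_joint W pT p1 p2;
          T = (\<lambda>(t, x1, x2, y). t);
          X1 = (\<lambda>(t, x1, x2, y). x1);
          X2 = (\<lambda>(t, x1, x2, y). x2);
          Y = (\<lambda>(t, x1, x2, y). y)
      in {(R1, R2). 0 \<le> R1 \<and> 0 \<le> R2 \<and>
            R1 \<le> cond_mutual_info J X1 Y (\<lambda>\<omega>. (X2 \<omega>, T \<omega>)) \<and>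
            R2 \<le> cond_mutual_info J X2 Y (\<lambda>\<omega>. (X1 \<omega>, T \<omega>)) \<and>
            R1 + R2 \<le> mutual_info J (\<lambda>\<omega>. (X1 \<omega>, X2 \<omega>)) Y})"

definition cl_inputs ::
  "'a set \<Rightarrow> 'b set \<Rightarrow> nat pmf \<Rightarrow> (nat \<Rightarrow> 'a pmf) \<Rightarrow> (nat \<Rightarrow> 'b pmf) \<Rightarrow> bool" where
  "cl_inputs A B pT p1 p2 \<longleftrightarrow>
     (\<forall>t\<in>set_pmf pT. set_pmf (p1 t) \<subseteq> A \<and> set_pmf (p2 t) \<subseteq> B)"

text \<open>Since only the number of values of the auxiliary variable matters, it is taken to be
  valued in the natural numbers.\<close>

definition cover_leung ::
  "'a set \<Rightarrow> 'b set \<Rightarrow> 'c set \<Rightarrow> ('a \<Rightarrow> 'b \<Rightarrow> 'c pmf) \<Rightarrow> (real \<times> real) set" where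
  "cover_leung A B C W =
     \<Union> {cl_rates W pT p1 p2 | pT p1 p2.
          finite (set_pmf pT) \<and> card (set_pmf pT) \<le> min (card A * card B + 1) (card C + 2) \<and>
          cl_inputs A B pT p1 p2}"

section \<open>The binary additive noisy channel\<close>

definition noisy_adder :: "nat \<Rightarrow> nat \<Rightarrow> nat pmf" where
  "noisy_adder x1 x2 = map_pmf (\<lambda>n. x1 + x2 + n) (pmf_of_set {0, 1})"

lemma set_pmf_noisy_adder:
  assumes "x1 \<in> {0, 1}" "x2 \<in> {0, 1}"
  shows "set_pmf (noisy_adder x1 x2) \<subseteq> {0, 1, 2, 3}"
  using assms by (auto simp: noisy_adder_def)

end

theory Submission
  imports Defs "HOL-Real_Asymp.Real_Asymp"
begin

text \<open>Let \<open>a t = P(X1 = 0 | T = t)\<close> and \<open>b t = P(X2 = 0 | T = t)\<close>. Conditioning on the other input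
  leaves an output law \<open>(a/2, 1/2, (1 - a)/2)\<close>, so the individual rates are bounded by \<open>E h(a) / 2\<close>
  and \<open>E h(b) / 2\<close>; the unconditional output law has entropy \<open>1 + (h(q0) + h(q2)) / 2\<close>, where
  \<open>q0 = E[a b]\<close> and \<open>q2 = E[(1 - a) (1 - b)]\<close>. Since \<open>v \<mapsto> h((1 - sqrt v) / 2)\<close> is concave, Jensen
  bounds \<open>E h(a)\<close> by its value at \<open>v = E[(1 - 2 a)\<^sup>2]\<close>; concavity of \<open>h\<close> together with Cauchy-Schwarz
  for \<open>E[(1 - 2 a) (1 - 2 b)]\<close> bounds the sum rate. All three bounds are attained at once by the
  symmetric inputs with a uniform binary \<open>T\<close>.\<close>


section \<open>Concavity\<close>

text \<open>By the mean value theorem the chord slopes on the two sides of an interior point are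
  values of \<open>f'\<close>, the left one dominating the right one. Derivatives are taken only in
  the open interval because \<open>binary_entropy\<close> has infinite slope at 0 and 1.\<close>

lemma concave_on_Icc_antitone_deriv:
  fixes f f' :: "real \<Rightarrow> real"
  assumes cont: "continuous_on {a..b} f"
    and deriv: "\<And>x. a < x \<Longrightarrow> x < b \<Longrightarrow> (f has_real_derivative f' x) (at x)"
    and anti: "\<And>x y. a < x \<Longrightarrow> x \<le> y \<Longrightarrow> y < b \<Longrightarrow> f' y \<le> f' x"
  shows "concave_on {a..b} f"
  unfolding concave_on_def
proof (rule convex_on_linorderI)
  fix t x y :: real
  assume t: "0 < t" "t < 1" and x: "x \<in> {a..b}" and y: "y \<in> {a..b}" and xy: "x < y"
  define z where "z = (1 - t) * x + t * y"
  have zx: "z - x = t * (y - x)" and yz: "y - z = (1 - t) * (y - x)"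
    by (simp_all add: z_def algebra_simps)
  have "0 < z - x" "0 < y - z"
    unfolding zx yz using t xy by simp_all
  then have z: "x < z" "z < y" by simp_all
  have mvt: "\<exists>\<xi>. u < \<xi> \<and> \<xi> < v \<and> f v - f u = (v - u) * f' \<xi>" if "a \<le> u" "u < v" "v \<le> b" for u v
  proof -
    have "continuous_on {u..v} f"
      using cont continuous_on_subset that by (metis atLeastatMost_subset_iff)
    moreover have "f differentiable (at w)" if "u < w" "w < v" for w
      using deriv[of w] that \<open>a \<le> u\<close> \<open>v \<le> b\<close> by (auto simp: real_differentiable_def)
    ultimately obtain l w where w: "u < w" "w < v" "(f has_real_derivative l) (at w)" "f v - f u = (v - u) * l"
      using MVT[OF \<open>u < v\<close>, of f] by blast
    moreover have "l = f' w"
      using DERIV_unique[OF w(3) deriv[of w]] w that by simp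
    ultimately show ?thesis by blast
  qed
  obtain c where c: "x < c" "c < z" "f z - f x = (z - x) * f' c"
    using mvt[of x z] x y z by auto
  obtain d where d: "z < d" "d < y" "f y - f z = (y - z) * f' d"
    using mvt[of z y] x y z by auto
  have "f' d \<le> f' c"
    using anti[of c d] c d x y by auto
  \<comment> \<open>Weighting the two mean value identities by \<open>1 - t\<close> and
    \<open>t\<close> gives both the factor \<open>(1 - t) * t * (y - x)\<close>.\<close>
  then have "(1 - t) * t * (y - x) * f' d \<le> (1 - t) * t * (y - x) * f' c"
    using t xy by (intro mult_left_mono) auto
  then have "t * (f y - f z) \<le> (1 - t) * (f z - f x)"
    unfolding c d zx yz by (simp add: mult_ac)
  then have "(1 - t) * f x + t * f y \<le> f z"
    by (simp add: algebra_simps)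
  then show "- f ((1 - t) *\<^sub>R x + t *\<^sub>R y) \<le> (1 - t) * - f x + t * - f y"
    by (simp add: z_def)
qed simp

section \<open>Binary entropy: continuity, derivative, concavity, monotonicity\<close>

lemma binary_entropy_0 [simp]: "binary_entropy 0 = 0"
  by (simp add: binary_entropy_def)

lemma binary_entropy_sym: "binary_entropy (1 - s) = binary_entropy s"
  by (simp add: binary_entropy_def algebra_simps)

lemma continuous_on_x_log_x: "continuous_on {0..} (\<lambda>x::real. x * log 2 x)"
  unfolding continuous_on
proof
  fix x :: real assume "x \<in> {0..}"
  show "((\<lambda>x. x * log 2 x) \<longlongrightarrow> x * log 2 x) (at x within {0..})"
  proof (cases "x = 0")
    case True
    \<comment> \<open>The factor \<open>x\<close> beats the logarithm, and the limit agrees with the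
      value of the product at 0.\<close>
    have "((\<lambda>x::real. x * log 2 x) \<longlongrightarrow> 0) (at_right 0)"
      by real_asymp
    then show ?thesis
      using True by (simp add: at_within_Ici_at_right)
  next
    case False
    then have "isCont (\<lambda>x. x * log 2 x) x"
      using \<open>x \<in> {0..}\<close> by (intro continuous_intros) auto
    then show ?thesis
      by (simp add: isCont_def tendsto_within_subset[of _ _ _ UNIV])
  qed
qed

lemma has_derivative_binary_entropy:
  assumes "0 < s" "s < 1"
  shows "(binary_entropy has_real_derivative log 2 ((1 - s) / s)) (at s)"
proof -
  have "(binary_entropy has_real_derivative
      (- log 2 s - s * (1 / (ln 2 * s))) - (- log 2 (1 - s) - (1 - s) * (1 / (ln 2 * (1 - s))))) (at s)"
    using assms unfolding binary_entropy_def[abs_def]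
    by (auto intro!: derivative_eq_intros)
  then show ?thesis
    using assms by (simp add: log_divide)
qed

lemma continuous_on_binary_entropy: "continuous_on {0..1} binary_entropy"
proof -
  have "continuous_on {0..1} (\<lambda>s. - (s * log 2 s) - (1 - s) * log 2 (1 - s))"
    by (intro continuous_intros continuous_on_subset[OF continuous_on_x_log_x]
        continuous_on_compose2[OF continuous_on_x_log_x, of _ "\<lambda>s. 1 - s"]) auto
  then show ?thesis
    by (simp add: binary_entropy_def[abs_def])
qed

lemma concave_on_binary_entropy: "concave_on {0..1} binary_entropy"
proof (rule concave_on_Icc_antitone_deriv[OF continuous_on_binary_entropy])
  fix x y :: real assume "0 < x" "x \<le> y" "y < 1"
  then have "(1 - y) / y \<le> (1 - x) / x" "0 < (1 - y) / y"
    by (auto intro!: frac_le)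
  then show "log 2 ((1 - y) / y) \<le> log 2 ((1 - x) / x)"
    by simp
qed (auto intro: has_derivative_binary_entropy)

lemma binary_entropy_mono:
  assumes "0 \<le> x" "x \<le> y" "y \<le> 1/2"
  shows "binary_entropy x \<le> binary_entropy y"
proof (rule DERIV_nonneg_imp_increasing_open[OF \<open>x \<le> y\<close>])
  show "continuous_on {x..y} binary_entropy"
    using assms by (intro continuous_on_subset[OF continuous_on_binary_entropy]) auto
next
  fix s assume "x < s" "s < y"
  then have s: "0 < s" "s < 1/2" using assms by auto
  then have "0 \<le> log 2 ((1 - s) / s)" by simp
  then show "\<exists>d. (binary_entropy has_real_derivative d) (at s) \<and> 0 \<le> d"
    using has_derivative_binary_entropy[of s] s by auto
qed

text \<open>\<open>ln ((1 + s) / (1 - s))\<close> is twice the inverse hyperbolic tangent: convex on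
  [0,1) and zero at the origin, so its chord slope from the origin increases.\<close>

lemma ln_ratio_div_mono:
  fixes r s :: real
  assumes "0 < s" "s \<le> r" "r < 1"
  shows "ln ((1 + s) / (1 - s)) / s \<le> ln ((1 + r) / (1 - r)) / r"
proof -
  define A where "A = (\<lambda>s::real. ln ((1 + s) / (1 - s)))"
  have "convex_on {0..<1} A"
  proof (rule convex_on_realI)
    fix x :: real assume "x \<in> {0..<1}"
    moreover from this have "x * x < 1"
      using abs_square_less_1[of x] by (simp add: power2_eq_square)
    ultimately show "(A has_real_derivative 2 / (1 - x\<^sup>2)) (at x)"
      unfolding A_def
      by (auto intro!: derivative_eq_intros simp: divide_simps power2_eq_square)
         (auto simp: algebra_simps power2_eq_square)
  next
    fix x y :: real assume "x \<in> {0..<1}" "y \<in> {0..<1}" "x \<le> y"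
    then show "2 / (1 - x\<^sup>2) \<le> 2 / (1 - y\<^sup>2)"
      by (auto intro!: divide_left_mono mult_pos_pos power_mono simp: power_strict_mono abs_square_less_1)
  qed auto
  \<comment> \<open>\<open>s\<close> is the convex combination of 0 and \<open>r\<close> with weight
    \<open>s / r\<close>, and \<open>A 0 = 0\<close>.\<close>
  from convex_onD[OF this, of "s / r" 0 r] have "A s \<le> s / r * A r"
    using assms by (simp add: A_def)
  then show ?thesis
    using assms by (simp add: A_def field_simps)
qed

text \<open>With \<open>s = sqrt v\<close> the derivative is a negative multiple of
  \<open>ln ((1 + s) / (1 - s)) / s\<close>, which increases with \<open>s\<close> by the previous
  lemma.\<close>

lemma concave_on_binary_entropy_sqrt:
  "concave_on {0..1} (\<lambda>v. binary_entropy ((1 - sqrt v) / 2))"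
proof (rule concave_on_Icc_antitone_deriv)
  show "continuous_on {0..1} (\<lambda>v. binary_entropy ((1 - sqrt v) / 2))"
    by (intro continuous_on_compose2[OF continuous_on_binary_entropy] continuous_intros)
       (auto intro!: order_trans[OF _ real_sqrt_ge_zero])
next
  fix v :: real assume v: "0 < v" "v < 1"
  have *: "((\<lambda>v. (1 - sqrt v) / 2) has_real_derivative - (1 / (4 * sqrt v))) (at v)"
    using v by (auto intro!: derivative_eq_intros simp: field_simps)
  have "0 < (1 - s) / 2 \<and> (1 - s) / 2 < 1" if "0 < s" "s < 1" for s :: real
    using that by simp
  from this[of "sqrt v"] have p: "0 < (1 - sqrt v) / 2" "(1 - sqrt v) / 2 < 1"
    using v by (simp_all only: real_sqrt_gt_0_iff real_sqrt_lt_1_iff)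
  have ratio: "(1 - (1 - s) / 2) / ((1 - s) / 2) = (1 + s) / (1 - s)" for s :: real
    by (simp add: diff_divide_distrib[symmetric] divide_simps) (simp add: algebra_simps)
  show "((\<lambda>v. binary_entropy ((1 - sqrt v) / 2)) has_real_derivative
      - (ln ((1 + sqrt v) / (1 - sqrt v)) / sqrt v) / (4 * ln 2)) (at v)"
    using DERIV_chain2[OF has_derivative_binary_entropy[OF p] *]
    unfolding ratio by (simp add: log_def mult_ac)
next
  fix x y :: real assume "0 < x" "x \<le> y" "y < 1"
  then have "ln ((1 + sqrt x) / (1 - sqrt x)) / sqrt x / (4 * ln 2)
      \<le> ln ((1 + sqrt y) / (1 - sqrt y)) / sqrt y / (4 * ln 2)"
    by (intro divide_right_mono ln_ratio_div_mono) auto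
  then show "- (ln ((1 + sqrt y) / (1 - sqrt y)) / sqrt y) / (4 * ln 2)
      \<le> - (ln ((1 + sqrt x) / (1 - sqrt x)) / sqrt x) / (4 * ln 2)"
    by (simp only: minus_divide_left[symmetric] neg_le_iff_le)
qed

section \<open>Entropy of probability mass functions\<close>

text \<open>Expected surprisal in bits. Integrating against \<open>p\<close> itself confines
  attention to the support, where the logarithm has a positive argument.\<close>

definition pmf_entropy :: "'a pmf \<Rightarrow> real" where
  "pmf_entropy p = (\<integral>x. - log 2 (pmf p x) \<partial>p)"

lemma distributed_measure_pmf:
  "distributed (measure_pmf p) (count_space UNIV) X (\<lambda>x. ennreal (pmf (map_pmf X p) x))"
  unfolding distributed_def
  by (simp add: map_pmf_rep_eq[symmetric] measure_pmf_eq_density[symmetric])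

lemma count_space_UNIV_pair:
  "count_space (UNIV :: 'a::countable set) \<Otimes>\<^sub>M count_space (UNIV :: 'b::countable set)
     = count_space UNIV"
  by (simp add: pair_measure_countable)

text \<open>On the support all three masses are positive, so the logarithm of the density ratio
  splits into surprisals, integrable by finite support. Countable types make the product of the
  discrete spaces discrete.\<close>

lemma mutual_info_eq_entropy:
  fixes X :: "'s \<Rightarrow> 'x::countable" and Y :: "'s \<Rightarrow> 'y::countable"
  assumes fin: "finite (set_pmf p)"
  shows "mutual_info p X Y =
    pmf_entropy (map_pmf X p) + pmf_entropy (map_pmf Y p) - pmf_entropy (map_pmf (\<lambda>\<omega>. (X \<omega>, Y \<omega>)) p)"
proof -
  interpret information_space "measure_pmf p" 2
    by unfold_locales simp
  define P where "P = map_pmf (\<lambda>\<omega>. (X \<omega>, Y \<omega>)) p"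
  let ?px = "pmf (map_pmf X p)" and ?py = "pmf (map_pmf Y p)"
  let ?g = "\<lambda>(x, y). log 2 (pmf P (x, y) / (?px x * ?py y))"
  have sf: "sigma_finite_measure (count_space (UNIV :: 'x set))"
    "sigma_finite_measure (count_space (UNIV :: 'y set))"
    by (simp_all add: sigma_finite_measure_count_space_countable)
  have "mutual_info p X Y = (\<integral>z. pmf P z * log 2 (pmf P z / (?px (fst z) * ?py (snd z)))
      \<partial>(count_space UNIV \<Otimes>\<^sub>M count_space UNIV))"
    unfolding mutual_info_def
    by (rule mutual_information_distr[OF sf(1) sf(2) distributed_measure_pmf _ distributed_measure_pmf])
       (auto simp: count_space_UNIV_pair P_def distributed_measure_pmf)
  also have "\<dots> = (\<integral>z. ?g z \<partial>P)"
    by (simp add: count_space_UNIV_pair measure_pmf_eq_density integral_density case_prod_beta)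
  also have "\<dots> = (\<integral>\<omega>. ?g (X \<omega>, Y \<omega>) \<partial>p)"
    by (simp add: P_def)
  also have "\<dots> = (\<integral>\<omega>. (- log 2 (?px (X \<omega>))) + (- log 2 (?py (Y \<omega>))) - (- log 2 (pmf P (X \<omega>, Y \<omega>))) \<partial>p)"
  proof (rule integral_cong_AE)
    show "AE \<omega> in p. ?g (X \<omega>, Y \<omega>) =
        (- log 2 (?px (X \<omega>))) + (- log 2 (?py (Y \<omega>))) - (- log 2 (pmf P (X \<omega>, Y \<omega>)))"
    proof (rule AE_pmfI)
      fix \<omega> assume "\<omega> \<in> set_pmf p"
      then have "?px (X \<omega>) > 0" "?py (Y \<omega>) > 0" "pmf P (X \<omega>, Y \<omega>) > 0"
        by (auto simp: P_def pmf_positive_iff)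
      then show "?g (X \<omega>, Y \<omega>) =
        (- log 2 (?px (X \<omega>))) + (- log 2 (?py (Y \<omega>))) - (- log 2 (pmf P (X \<omega>, Y \<omega>)))"
        by (simp add: log_divide log_mult)
    qed
  qed auto
  also have "\<dots> = (\<integral>\<omega>. - log 2 (?px (X \<omega>)) \<partial>p) + (\<integral>\<omega>. - log 2 (?py (Y \<omega>)) \<partial>p)
      - (\<integral>\<omega>. - log 2 (pmf P (X \<omega>, Y \<omega>)) \<partial>p)"
    by (simp add: integrable_measure_pmf_finite[OF fin])
  finally show ?thesis
    by (simp add: pmf_entropy_def P_def)
qed

text \<open>By definition this quantity is \<open>I(X;(Y,Z)) - I(X;Z)\<close>, and
  \<open>H(X)\<close> cancels. The grouping reads \<open>H(Y|Z) - H(Y|X,Z)\<close>, ready for the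
  chain rule.\<close>

lemma cond_mutual_info_eq_entropy:
  fixes X :: "'s \<Rightarrow> 'x::countable" and Y :: "'s \<Rightarrow> 'y::countable" and Z :: "'s \<Rightarrow> 'z::countable"
  assumes fin: "finite (set_pmf p)"
  shows "cond_mutual_info p X Y Z =
    pmf_entropy (map_pmf (\<lambda>\<omega>. (Y \<omega>, Z \<omega>)) p) - pmf_entropy (map_pmf Z p)
    - (pmf_entropy (map_pmf (\<lambda>\<omega>. (X \<omega>, Y \<omega>, Z \<omega>)) p) - pmf_entropy (map_pmf (\<lambda>\<omega>. (X \<omega>, Z \<omega>)) p))"
proof -
  have "cond_mutual_info p X Y Z = mutual_info p X (\<lambda>\<omega>. (Y \<omega>, Z \<omega>)) - mutual_info p X Z"
    unfolding cond_mutual_info_def mutual_info_def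
    by (simp add: prob_space.conditional_mutual_information_def[OF measure_pmf.prob_space_axioms] count_space_UNIV_pair)
  then show ?thesis
    by (simp add: mutual_info_eq_entropy[OF fin])
qed

lemma pmf_entropy_map_inj:
  assumes "inj_on f (set_pmf p)"
  shows "pmf_entropy (map_pmf f p) = pmf_entropy p"
  unfolding pmf_entropy_def
  by (simp, rule integral_cong_AE) (auto intro!: AE_pmfI simp: pmf_map_inj[OF assms])

lemma pmf_entropy_eq_sum:
  assumes "finite A" "set_pmf p \<subseteq> A"
  shows "pmf_entropy p = (\<Sum>x\<in>A. - pmf p x * log 2 (pmf p x))"
  unfolding pmf_entropy_def using assms
  by (subst integral_measure_pmf[of A]) auto

text \<open>The premise says that \<open>K z\<close> is the conditional law of \<open>Y\<close> given \<open>Z = z\<close>.\<close>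

lemma pmf_entropy_chain:
  fixes Y :: "'s \<Rightarrow> 'y" and Z :: "'s \<Rightarrow> 'z"
  assumes fin: "finite (set_pmf p)"
    and K: "map_pmf (\<lambda>\<omega>. (Y \<omega>, Z \<omega>)) p = bind_pmf p (\<lambda>\<omega>. map_pmf (\<lambda>y. (y, Z \<omega>)) (K (Z \<omega>)))"
  shows "pmf_entropy (map_pmf (\<lambda>\<omega>. (Y \<omega>, Z \<omega>)) p) =
    pmf_entropy (map_pmf Z p) + (\<integral>\<omega>. pmf_entropy (K (Z \<omega>)) \<partial>p)"
proof -
  define q where "q = map_pmf Z p"
  define P where "P = map_pmf (\<lambda>\<omega>. (Y \<omega>, Z \<omega>)) p"
  have finq: "finite (set_pmf q)" and finP: "finite (set_pmf P)"
    using fin by (auto simp: q_def P_def)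
  have P: "P = bind_pmf q (\<lambda>z. map_pmf (\<lambda>y. (y, z)) (K z))"
    unfolding P_def K q_def by (simp add: bind_map_pmf)
  \<comment> \<open>For fixed \<open>z\<close> the support of \<open>K z\<close> embeds into that of
    the joint law.\<close>
  have finK: "finite (set_pmf (K z))" if "z \<in> set_pmf q" for z
  proof -
    have "(\<lambda>y. (y, z)) ` set_pmf (K z) \<subseteq> set_pmf P"
      using that by (auto simp: P)
    then have "finite ((\<lambda>y. (y, z)) ` set_pmf (K z))"
      using finP finite_subset by blast
    then show ?thesis
      by (rule finite_imageD) (simp add: inj_on_def)
  qed
  \<comment> \<open>The pair records \<open>z\<close>, so only \<open>z' = z\<close> contributes to
    the mixture.\<close>
  have pmfP: "pmf P (y, z) = pmf q z * pmf (K z) y" for y z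
  proof -
    have "pmf P (y, z) = (\<integral>z'. pmf (map_pmf (\<lambda>y. (y, z')) (K z')) (y, z) \<partial>q)"
      by (simp add: P pmf_bind)
    also have "\<dots> = (\<Sum>z'\<in>{z}. pmf q z' *\<^sub>R pmf (map_pmf (\<lambda>y. (y, z')) (K z')) (y, z))"
      by (rule integral_measure_pmf) (auto simp: pmf_eq_0_set_pmf)
    also have "\<dots> = pmf q z * pmf (K z) y"
      using pmf_map_inj'[of "\<lambda>y. (y, z)" "K z" y] by (simp add: inj_on_def)
    finally show ?thesis .
  qed
  have "pmf_entropy P = (\<Sum>z\<in>set_pmf q. pmf q z * (\<integral>y. - log 2 (pmf P (y, z)) \<partial>K z))"
    unfolding pmf_entropy_def
    using pmf_expectation_bind[OF finq, of "\<lambda>z. map_pmf (\<lambda>y. (y, z)) (K z)" q "\<lambda>x. - log 2 (pmf P x)"]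
    by (simp add: finK P[symmetric])
  also have "\<dots> = (\<Sum>z\<in>set_pmf q. pmf q z * (- log 2 (pmf q z) + pmf_entropy (K z)))"
  proof (rule sum.cong[OF refl])
    fix z assume z: "z \<in> set_pmf q"
    have "(\<integral>y. - log 2 (pmf P (y, z)) \<partial>K z) = (\<integral>y. - log 2 (pmf q z) + (- log 2 (pmf (K z) y)) \<partial>K z)"
    proof (rule integral_cong_AE)
      show "AE y in K z. - log 2 (pmf P (y, z)) = - log 2 (pmf q z) + (- log 2 (pmf (K z) y))"
        using z by (auto intro!: AE_pmfI simp: pmfP log_mult pmf_eq_0_set_pmf)
    qed auto
    also have "\<dots> = - log 2 (pmf q z) + pmf_entropy (K z)"
      unfolding pmf_entropy_def
      by (subst Bochner_Integration.integral_add)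
         (simp_all add: integrable_measure_pmf_finite finK[OF z])
    finally show "pmf q z * (\<integral>y. - log 2 (pmf P (y, z)) \<partial>K z)
        = pmf q z * (- log 2 (pmf q z) + pmf_entropy (K z))"
      by simp
  qed
  also have "\<dots> = pmf_entropy q + (\<integral>z. pmf_entropy (K z) \<partial>q)"
    by (simp add: pmf_entropy_eq_sum[OF finq order.refl] integral_measure_pmf[OF finq]
        right_diff_distrib sum_subtractf sum_negf)
  finally show ?thesis
    by (simp add: q_def P_def)
qed

section \<open>The rate constraints\<close>

lemma finite_set_pmf_cl_joint:
  assumes "finite (set_pmf pT)" "\<And>t. t \<in> set_pmf pT \<Longrightarrow> finite (set_pmf (p1 t))"
    "\<And>t. t \<in> set_pmf pT \<Longrightarrow> finite (set_pmf (p2 t))" "\<And>x1 x2. finite (set_pmf (W x1 x2))"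
  shows "finite (set_pmf (cl_joint W pT p1 p2))"
  using assms by (simp add: cl_joint_def)

lemma map_pmf_cl_joint:
  "map_pmf f (cl_joint W pT p1 p2) =
     bind_pmf pT (\<lambda>t. bind_pmf (p1 t) (\<lambda>x1. bind_pmf (p2 t) (\<lambda>x2.
       map_pmf (\<lambda>y. f (t, x1, x2, y)) (W x1 x2))))"
  by (simp add: cl_joint_def map_bind_pmf map_pmf_def bind_assoc_pmf bind_return_pmf)

lemma bind_pmf_cl_joint:
  "bind_pmf (cl_joint W pT p1 p2) g =
     bind_pmf pT (\<lambda>t. bind_pmf (p1 t) (\<lambda>x1. bind_pmf (p2 t) (\<lambda>x2.
       bind_pmf (W x1 x2) (\<lambda>y. g (t, x1, x2, y)))))"
  by (simp add: cl_joint_def bind_assoc_pmf bind_return_pmf)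

text \<open>The inputs are independent given \<open>t\<close>, so they may be drawn in either order.
  This reduces the second user's rate to the first's.\<close>

lemma cl_joint_swap:
  "cl_joint (\<lambda>x2 x1. W x1 x2) pT p2 p1 = map_pmf (\<lambda>(t, x1, x2, y). (t, x2, x1, y)) (cl_joint W pT p1 p2)"
  unfolding map_pmf_cl_joint unfolding cl_joint_def map_pmf_def
  by (subst bind_commute_pmf) simp

text \<open>These four are the projections bound by the \<open>let\<close> in
  \<open>cl_rates\<close>, so the lemmas below match its unfolded form.\<close>

abbreviation (input) cl_T :: "nat \<times> 'a \<times> 'b \<times> 'c \<Rightarrow> nat" where "cl_T \<equiv> \<lambda>(t, x1, x2, y). t"
abbreviation (input) cl_X1 :: "nat \<times> 'a \<times> 'b \<times> 'c \<Rightarrow> 'a" where "cl_X1 \<equiv> \<lambda>(t, x1, x2, y). x1"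
abbreviation (input) cl_X2 :: "nat \<times> 'a \<times> 'b \<times> 'c \<Rightarrow> 'b" where "cl_X2 \<equiv> \<lambda>(t, x1, x2, y). x2"
abbreviation (input) cl_Y :: "nat \<times> 'a \<times> 'b \<times> 'c \<Rightarrow> 'c" where "cl_Y \<equiv> \<lambda>(t, x1, x2, y). y"

text \<open>Two chain rules evaluate \<open>H(Y|X2,T) - H(Y|X1,X2,T)\<close>: the first kernel mixes
  \<open>W\<close> over \<open>p1 t\<close>, the second is \<open>W\<close> alone.\<close>

lemma cond_mutual_info_cl_joint:
  fixes W :: "'a::countable \<Rightarrow> 'b::countable \<Rightarrow> 'c::countable pmf"
  assumes fin: "finite (set_pmf (cl_joint W pT p1 p2))"
  shows "cond_mutual_info (cl_joint W pT p1 p2) cl_X1 cl_Y (\<lambda>\<omega>. (cl_X2 \<omega>, cl_T \<omega>)) =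
    (\<integral>\<omega>. pmf_entropy (bind_pmf (p1 (cl_T \<omega>)) (\<lambda>x1. W x1 (cl_X2 \<omega>)))
         - pmf_entropy (W (cl_X1 \<omega>) (cl_X2 \<omega>)) \<partial>cl_joint W pT p1 p2)"
proof -
  let ?J = "cl_joint W pT p1 p2"
  \<comment> \<open>Given \<open>X2\<close> and \<open>T\<close>, the law of \<open>X1\<close> is
    still \<open>p1 t\<close>; commuting the two draws expresses this conditional
    independence.\<close>
  have 1: "pmf_entropy (map_pmf (\<lambda>\<omega>. (cl_Y \<omega>, cl_X2 \<omega>, cl_T \<omega>)) ?J) =
    pmf_entropy (map_pmf (\<lambda>\<omega>. (cl_X2 \<omega>, cl_T \<omega>)) ?J)
    + (\<integral>\<omega>. pmf_entropy ((\<lambda>(x2, t). bind_pmf (p1 t) (\<lambda>x1. W x1 x2)) (cl_X2 \<omega>, cl_T \<omega>)) \<partial>?J)"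
    by (rule pmf_entropy_chain[OF fin], unfold map_pmf_cl_joint bind_pmf_cl_joint,
        subst bind_commute_pmf) (simp add: map_bind_pmf)
  have 2: "pmf_entropy (map_pmf (\<lambda>\<omega>. (cl_Y \<omega>, cl_X1 \<omega>, cl_X2 \<omega>, cl_T \<omega>)) ?J) =
    pmf_entropy (map_pmf (\<lambda>\<omega>. (cl_X1 \<omega>, cl_X2 \<omega>, cl_T \<omega>)) ?J)
    + (\<integral>\<omega>. pmf_entropy ((\<lambda>(x1, x2, t). W x1 x2) (cl_X1 \<omega>, cl_X2 \<omega>, cl_T \<omega>)) \<partial>?J)"
    by (rule pmf_entropy_chain[OF fin], unfold map_pmf_cl_joint bind_pmf_cl_joint) simp
  \<comment> \<open>The chain rule wants \<open>Y\<close> as first component; the reordering is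
    injective and keeps the entropy.\<close>
  have "map_pmf (\<lambda>\<omega>. (cl_X1 \<omega>, cl_Y \<omega>, cl_X2 \<omega>, cl_T \<omega>)) ?J =
      map_pmf (\<lambda>(y, x1, z). (x1, y, z)) (map_pmf (\<lambda>\<omega>. (cl_Y \<omega>, cl_X1 \<omega>, cl_X2 \<omega>, cl_T \<omega>)) ?J)"
    by (simp add: map_pmf_comp)
  then have 3: "pmf_entropy (map_pmf (\<lambda>\<omega>. (cl_X1 \<omega>, cl_Y \<omega>, cl_X2 \<omega>, cl_T \<omega>)) ?J) =
      pmf_entropy (map_pmf (\<lambda>\<omega>. (cl_Y \<omega>, cl_X1 \<omega>, cl_X2 \<omega>, cl_T \<omega>)) ?J)"
    by (simp only:) (rule pmf_entropy_map_inj, auto simp: inj_on_def)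
  show ?thesis
    unfolding cond_mutual_info_eq_entropy[OF fin] 3 1 2
    by (simp add: integrable_measure_pmf_finite[OF fin])
qed

lemma cond_mutual_info_cl_joint_swap:
  fixes W :: "'a::countable \<Rightarrow> 'b::countable \<Rightarrow> 'c::countable pmf"
  assumes fin: "finite (set_pmf (cl_joint W pT p1 p2))"
  shows "cond_mutual_info (cl_joint W pT p1 p2) cl_X2 cl_Y (\<lambda>\<omega>. (cl_X1 \<omega>, cl_T \<omega>)) =
    cond_mutual_info (cl_joint (\<lambda>x2 x1. W x1 x2) pT p2 p1) cl_X1 cl_Y (\<lambda>\<omega>. (cl_X2 \<omega>, cl_T \<omega>))"
proof -
  have fin': "finite (set_pmf (cl_joint (\<lambda>x2 x1. W x1 x2) pT p2 p1))"
    using fin by (simp add: cl_joint_swap[of W])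
  show ?thesis
    unfolding cond_mutual_info_eq_entropy[OF fin] cond_mutual_info_eq_entropy[OF fin']
    by (simp add: cl_joint_swap[of W] map_pmf_comp case_prod_beta)
qed

lemma mutual_info_cl_joint:
  fixes W :: "'a::countable \<Rightarrow> 'b::countable \<Rightarrow> 'c::countable pmf"
  assumes fin: "finite (set_pmf (cl_joint W pT p1 p2))"
  shows "mutual_info (cl_joint W pT p1 p2) (\<lambda>\<omega>. (cl_X1 \<omega>, cl_X2 \<omega>)) cl_Y =
    pmf_entropy (map_pmf cl_Y (cl_joint W pT p1 p2))
    - (\<integral>\<omega>. pmf_entropy (W (cl_X1 \<omega>) (cl_X2 \<omega>)) \<partial>cl_joint W pT p1 p2)"
proof -
  let ?J = "cl_joint W pT p1 p2"
  have 1: "pmf_entropy (map_pmf (\<lambda>\<omega>. (cl_Y \<omega>, cl_X1 \<omega>, cl_X2 \<omega>)) ?J) =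
    pmf_entropy (map_pmf (\<lambda>\<omega>. (cl_X1 \<omega>, cl_X2 \<omega>)) ?J)
    + (\<integral>\<omega>. pmf_entropy ((\<lambda>(x1, x2). W x1 x2) (cl_X1 \<omega>, cl_X2 \<omega>)) \<partial>?J)"
    by (rule pmf_entropy_chain[OF fin], unfold map_pmf_cl_joint bind_pmf_cl_joint) simp
  have "map_pmf (\<lambda>\<omega>. ((cl_X1 \<omega>, cl_X2 \<omega>), cl_Y \<omega>)) ?J =
      map_pmf (\<lambda>(y, z). (z, y)) (map_pmf (\<lambda>\<omega>. (cl_Y \<omega>, cl_X1 \<omega>, cl_X2 \<omega>)) ?J)"
    by (simp add: map_pmf_comp)
  then have 2: "pmf_entropy (map_pmf (\<lambda>\<omega>. ((cl_X1 \<omega>, cl_X2 \<omega>), cl_Y \<omega>)) ?J) =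
      pmf_entropy (map_pmf (\<lambda>\<omega>. (cl_Y \<omega>, cl_X1 \<omega>, cl_X2 \<omega>)) ?J)"
    by (simp only:) (rule pmf_entropy_map_inj, auto simp: inj_on_def)
  show ?thesis
    unfolding mutual_info_eq_entropy[OF fin] 2 1 by simp
qed

section \<open>The noisy adder: output entropies and explicit rates\<close>

lemma noisy_adder_eq_uniform: "noisy_adder a b = pmf_of_set {a + b, Suc (a + b)}"
  unfolding noisy_adder_def by (subst map_pmf_of_set_inj) (auto simp: inj_on_def)

lemma pmf_noisy_adder:
  "pmf (noisy_adder a b) k = (if k = a + b \<or> k = Suc (a + b) then 1 / 2 else 0)"
  by (simp add: noisy_adder_eq_uniform indicator_def)

text \<open>A known second input only translates the output, which leaves its entropy
  unchanged.\<close>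

lemma noisy_adder_shift: "noisy_adder a b = map_pmf ((+) b) (noisy_adder a 0)"
  by (simp add: noisy_adder_def map_pmf_comp add_ac)

lemma noisy_adder_commute: "noisy_adder a b = noisy_adder b a"
  by (simp add: noisy_adder_def add_ac)

lemma finite_set_pmf_noisy_adder: "finite (set_pmf (noisy_adder a b))"
  by (simp add: noisy_adder_def)

lemma pmf_entropy_noisy_adder: "pmf_entropy (noisy_adder a b) = 1"
  by (subst pmf_entropy_eq_sum[of "{a + b, Suc (a + b)}"])
     (auto simp: pmf_noisy_adder log_divide noisy_adder_eq_uniform)

lemma half_mult_log_half:
  assumes "0 \<le> x"
  shows "- (x / 2) * log 2 (x / 2) = x / 2 - x * log 2 x / 2"
  using assms by (cases "x = 0") (auto simp: log_divide field_simps)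

text \<open>The output distribution pairs up as \<open>s 0 / 2, (1 - s 0) / 2\<close> and \<open>s 2 / 2, (1 - s 2) / 2\<close>.\<close>

lemma pmf_entropy_bind_noisy_adder:
  assumes s: "set_pmf s \<subseteq> {0, 1, 2}"
  shows "pmf_entropy (bind_pmf s (\<lambda>x. noisy_adder x 0)) =
    1 + (binary_entropy (pmf s 0) + binary_entropy (pmf s 2)) / 2"
proof -
  let ?P = "bind_pmf s (\<lambda>x. noisy_adder x 0)"
  have sum1: "pmf s 0 + pmf s 1 + pmf s 2 = 1"
    using sum_pmf_eq_1[OF _ s] by (simp add: add_ac)
  have pmf: "pmf ?P k = pmf s 0 * pmf (noisy_adder 0 0) k + pmf s 1 * pmf (noisy_adder 1 0) k
      + pmf s 2 * pmf (noisy_adder 2 0) k" for k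
    unfolding pmf_bind using s by (subst integral_measure_pmf[of "{0, 1, 2}"]) auto
  \<comment> \<open>Output 1 comes from input sums 0 and 1, so its mass is
    \<open>(pmf s 0 + pmf s 1) / 2\<close>; output 2 comes from sums 1 and 2.\<close>
  have vals: "pmf ?P 0 = pmf s 0 / 2" "pmf ?P 1 = (1 - pmf s 2) / 2" "pmf ?P 2 = (1 - pmf s 0) / 2"
    "pmf ?P 3 = pmf s 2 / 2"
    using sum1 by (auto simp: pmf pmf_noisy_adder field_simps)
  have "set_pmf ?P \<subseteq> {0, 1, 2, 3}"
    using s by (auto simp: noisy_adder_eq_uniform)
  then have "pmf_entropy ?P = (\<Sum>x\<in>{0, 1, 2, 3}. - pmf ?P x * log 2 (pmf ?P x))"
    by (intro pmf_entropy_eq_sum) auto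
  also have "\<dots> = - (pmf s 0 / 2) * log 2 (pmf s 0 / 2) + (- ((1 - pmf s 2) / 2) * log 2 ((1 - pmf s 2) / 2)
      + (- ((1 - pmf s 0) / 2) * log 2 ((1 - pmf s 0) / 2) + - (pmf s 2 / 2) * log 2 (pmf s 2 / 2)))"
    by (simp add: vals vals(2)[unfolded One_nat_def])
  \<comment> \<open>Halving the four masses contributes one bit in total; the remaining terms pair
    up into two binary entropies.\<close>
  also have "\<dots> = 1 + (binary_entropy (pmf s 0) + binary_entropy (pmf s 2)) / 2"
    by (subst half_mult_log_half, simp add: pmf_le_1)+
       (simp add: binary_entropy_def field_simps)
  finally show ?thesis .
qed

lemma pmf_entropy_bind_noisy_adder_binary:
  assumes p: "set_pmf p \<subseteq> {0, 1}"
  shows "pmf_entropy (bind_pmf p (\<lambda>x1. noisy_adder x1 x2)) = 1 + binary_entropy (pmf p 0) / 2"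
proof -
  have "bind_pmf p (\<lambda>x1. noisy_adder x1 x2) = map_pmf ((+) x2) (bind_pmf p (\<lambda>x. noisy_adder x 0))"
    by (simp add: map_bind_pmf noisy_adder_shift[of _ x2])
  moreover have "pmf p 2 = 0" "set_pmf p \<subseteq> {0, 1, 2}"
    using p by (auto simp: pmf_eq_0_set_pmf)
  ultimately show ?thesis
    by (simp add: pmf_entropy_map_inj pmf_entropy_bind_noisy_adder)
qed

text \<open>The one bit of noise entropy cancels the constant 1 in the output entropy. What remains
  depends on \<open>T\<close> alone, so the expectation descends to \<open>pT\<close>.\<close>

lemma cond_mutual_info_noisy_adder:
  assumes inp: "cl_inputs {0, 1} {0, 1} pT p1 p2"
    and fin: "finite (set_pmf (cl_joint noisy_adder pT p1 p2))"
  shows "cond_mutual_info (cl_joint noisy_adder pT p1 p2) cl_X1 cl_Y (\<lambda>\<omega>. (cl_X2 \<omega>, cl_T \<omega>)) =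
    1 / 2 * (\<integral>t. binary_entropy (pmf (p1 t) 0) \<partial>pT)"
proof -
  let ?J = "cl_joint noisy_adder pT p1 p2"
  have T: "map_pmf cl_T ?J = pT"
    by (simp add: map_pmf_cl_joint map_pmf_const bind_return_pmf')
  have "(\<integral>\<omega>. pmf_entropy (bind_pmf (p1 (cl_T \<omega>)) (\<lambda>x1. noisy_adder x1 (cl_X2 \<omega>)))
         - pmf_entropy (noisy_adder (cl_X1 \<omega>) (cl_X2 \<omega>)) \<partial>?J)
    = (\<integral>\<omega>. binary_entropy (pmf (p1 (cl_T \<omega>)) 0) / 2 \<partial>?J)"
  proof (rule integral_cong_AE)
    have "cl_T \<omega> \<in> set_pmf pT" if "\<omega> \<in> set_pmf ?J" for \<omega>
      using that by (subst T[symmetric]) auto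
    then show "AE \<omega> in ?J. pmf_entropy (bind_pmf (p1 (cl_T \<omega>)) (\<lambda>x1. noisy_adder x1 (cl_X2 \<omega>)))
         - pmf_entropy (noisy_adder (cl_X1 \<omega>) (cl_X2 \<omega>)) = binary_entropy (pmf (p1 (cl_T \<omega>)) 0) / 2"
      using inp by (intro AE_pmfI)
        (simp add: cl_inputs_def pmf_entropy_bind_noisy_adder_binary pmf_entropy_noisy_adder)
  qed auto
  also have "\<dots> = (\<integral>t. binary_entropy (pmf (p1 t) 0) / 2 \<partial>map_pmf cl_T ?J)"
    by simp
  finally show ?thesis
    unfolding T by (simp add: cond_mutual_info_cl_joint[OF fin])
qed

text \<open>The output sees the inputs only through their sum \<open>S\<close>, and sums 0 and 2
  each arise from a single input pair. The noise bit cancels again.\<close>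

lemma mutual_info_noisy_adder:
  assumes inp: "cl_inputs {0, 1} {0, 1} pT p1 p2"
    and fin: "finite (set_pmf (cl_joint noisy_adder pT p1 p2))"
  shows "mutual_info (cl_joint noisy_adder pT p1 p2) (\<lambda>\<omega>. (cl_X1 \<omega>, cl_X2 \<omega>)) cl_Y =
    (binary_entropy (\<integral>t. pmf (p1 t) 0 * pmf (p2 t) 0 \<partial>pT)
     + binary_entropy (\<integral>t. pmf (p1 t) 1 * pmf (p2 t) 1 \<partial>pT)) / 2"
proof -
  let ?J = "cl_joint noisy_adder pT p1 p2"
  define S where "S = bind_pmf pT (\<lambda>t. bind_pmf (p1 t) (\<lambda>x1. bind_pmf (p2 t) (\<lambda>x2. return_pmf (x1 + x2))))"
  have "noisy_adder x1 x2 = noisy_adder (x1 + x2) 0" for x1 x2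
    by (simp add: noisy_adder_def)
  then have Y: "map_pmf cl_Y ?J = bind_pmf S (\<lambda>x. noisy_adder x 0)"
    by (simp add: S_def map_pmf_cl_joint bind_assoc_pmf bind_return_pmf)
  have supp: "set_pmf (p1 t) \<subseteq> {0, 1}" "set_pmf (p2 t) \<subseteq> {0, 1}" if "t \<in> set_pmf pT" for t
    using inp that by (auto simp: cl_inputs_def)
  have S: "set_pmf S \<subseteq> {0, 1, 2}"
    using supp by (fastforce simp: S_def)
  \<comment> \<open>Expansion over the four input pairs; the indicators select those whose sum is
    \<open>k\<close>.\<close>
  have pmf_S: "pmf S k = (\<integral>t. pmf (p1 t) 0 * pmf (p2 t) 0 * indicator {k} 0
        + (pmf (p1 t) 0 * pmf (p2 t) 1 + pmf (p1 t) 1 * pmf (p2 t) 0) * indicator {k} 1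
        + pmf (p1 t) 1 * pmf (p2 t) 1 * indicator {k} 2 \<partial>pT)" for k
    unfolding S_def pmf_bind
  proof (rule integral_cong_AE)
    show "AE t in pT. (\<integral>x1. (\<integral>x2. pmf (return_pmf (x1 + x2)) k \<partial>p2 t) \<partial>p1 t)
      = pmf (p1 t) 0 * pmf (p2 t) 0 * indicator {k} 0
        + (pmf (p1 t) 0 * pmf (p2 t) 1 + pmf (p1 t) 1 * pmf (p2 t) 0) * indicator {k} 1
        + pmf (p1 t) 1 * pmf (p2 t) 1 * indicator {k} 2"
    proof (rule AE_pmfI)
      fix t assume t: "t \<in> set_pmf pT"
      have "(\<integral>x2. g x2 \<partial>p2 t) = (\<Sum>x2\<in>{0, 1}. pmf (p2 t) x2 *\<^sub>R g x2)" for g :: "nat \<Rightarrow> real"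
        using supp(2)[OF t] by (intro integral_measure_pmf) auto
      moreover have "(\<integral>x1. g x1 \<partial>p1 t) = (\<Sum>x1\<in>{0, 1}. pmf (p1 t) x1 *\<^sub>R g x1)" for g :: "nat \<Rightarrow> real"
        using supp(1)[OF t] by (intro integral_measure_pmf) auto
      ultimately show "(\<integral>x1. (\<integral>x2. pmf (return_pmf (x1 + x2)) k \<partial>p2 t) \<partial>p1 t)
      = pmf (p1 t) 0 * pmf (p2 t) 0 * indicator {k} 0
        + (pmf (p1 t) 0 * pmf (p2 t) 1 + pmf (p1 t) 1 * pmf (p2 t) 0) * indicator {k} 1
        + pmf (p1 t) 1 * pmf (p2 t) 1 * indicator {k} 2"
        by (simp add: algebra_simps numeral_2_eq_2)
    qed
  qed auto
  have "pmf S 0 = (\<integral>t. pmf (p1 t) 0 * pmf (p2 t) 0 \<partial>pT)" "pmf S 2 = (\<integral>t. pmf (p1 t) 1 * pmf (p2 t) 1 \<partial>pT)"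
    by (simp_all add: pmf_S)
  then show ?thesis
    by (simp add: mutual_info_cl_joint[OF fin] pmf_entropy_noisy_adder Y
        pmf_entropy_bind_noisy_adder[OF S])
qed

lemma cl_rates_noisy_adder:
  assumes finT: "finite (set_pmf pT)" and inp: "cl_inputs {0, 1} {0, 1} pT p1 p2"
  shows "cl_rates noisy_adder pT p1 p2 = {(R1, R2). 0 \<le> R1 \<and> 0 \<le> R2 \<and>
     R1 \<le> 1 / 2 * (\<integral>t. binary_entropy (pmf (p1 t) 0) \<partial>pT) \<and>
     R2 \<le> 1 / 2 * (\<integral>t. binary_entropy (pmf (p2 t) 0) \<partial>pT) \<and>
     R1 + R2 \<le> (binary_entropy (\<integral>t. pmf (p1 t) 0 * pmf (p2 t) 0 \<partial>pT)
       + binary_entropy (\<integral>t. pmf (p1 t) 1 * pmf (p2 t) 1 \<partial>pT)) / 2}"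
proof -
  have supp: "finite (set_pmf (p1 t))" "finite (set_pmf (p2 t))" if "t \<in> set_pmf pT" for t
    using inp that unfolding cl_inputs_def by (meson finite.emptyI finite.insertI finite_subset)+
  have fin: "finite (set_pmf (cl_joint noisy_adder pT p1 p2))"
    "finite (set_pmf (cl_joint noisy_adder pT p2 p1))"
    using finT supp by (auto intro!: finite_set_pmf_cl_joint simp: finite_set_pmf_noisy_adder)
  have inp': "cl_inputs {0, 1} {0, 1} pT p2 p1"
    using inp by (auto simp: cl_inputs_def)
  \<comment> \<open>The channel is symmetric in its inputs, so the first user's formula also serves
    the second with \<open>p1\<close> and \<open>p2\<close> exchanged.\<close>
  have sw: "(\<lambda>x2 x1. noisy_adder x1 x2) = noisy_adder"
    by (intro ext) (rule noisy_adder_commute)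
  show ?thesis
    unfolding cl_rates_def Let_def cond_mutual_info_cl_joint_swap[OF fin(1)] sw
      cond_mutual_info_noisy_adder[OF inp fin(1)] cond_mutual_info_noisy_adder[OF inp' fin(2)]
      mutual_info_noisy_adder[OF inp fin(1)] ..
qed

section \<open>The region\<close>

lemma measure_pmf_jensen_concave:
  fixes f :: "real \<Rightarrow> real"
  assumes fin: "finite (set_pmf p)" and f: "concave_on C f" and C: "\<And>t. t \<in> set_pmf p \<Longrightarrow> g t \<in> C"
  shows "(\<integral>t. f (g t) \<partial>p) \<le> f (\<integral>t. g t \<partial>p)"
proof -
  have "(\<Sum>t\<in>set_pmf p. pmf p t * f (g t)) \<le> f (\<Sum>t\<in>set_pmf p. pmf p t *\<^sub>R g t)"
    using fin C by (intro concave_on_sum[OF _ _ f]) (auto simp: set_pmf_not_empty sum_pmf_eq_1)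
  then show ?thesis
    by (simp add: integral_measure_pmf[OF fin])
qed

lemma measure_pmf_cauchy_schwarz:
  fixes x y :: "'a \<Rightarrow> real"
  assumes fin: "finite (set_pmf p)"
  shows "(\<integral>t. x t * y t \<partial>p) \<le> sqrt ((\<integral>t. (x t)\<^sup>2 \<partial>p) * (\<integral>t. (y t)\<^sup>2 \<partial>p))"
proof -
  \<comment> \<open>Each weight is split evenly as a product of square roots between the two
    factors.\<close>
  have "(\<Sum>t\<in>set_pmf p. (sqrt (pmf p t) * x t) * (sqrt (pmf p t) * y t))\<^sup>2
    \<le> (\<Sum>t\<in>set_pmf p. (sqrt (pmf p t) * x t)\<^sup>2) * (\<Sum>t\<in>set_pmf p. (sqrt (pmf p t) * y t)\<^sup>2)"
    by (rule Cauchy_Schwarz_ineq_sum)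
  moreover have "(sqrt (pmf p t) * x t) * (sqrt (pmf p t) * y t) = pmf p t * (x t * y t)" for t
    using real_sqrt_mult_self[of "pmf p t"] by (simp add: mult_ac)
  ultimately have "(\<integral>t. x t * y t \<partial>p)\<^sup>2 \<le> (\<integral>t. (x t)\<^sup>2 \<partial>p) * (\<integral>t. (y t)\<^sup>2 \<partial>p)"
    by (simp add: integral_measure_pmf[OF fin] power_mult_distrib)
  then show ?thesis
    by (rule real_le_rsqrt)
qed

text \<open>The root is \<open>\<bar>1 - 2 * a\<bar>\<close>, so the argument is the smaller of
  \<open>a\<close> and \<open>1 - a\<close>, and entropy is symmetric.\<close>

lemma binary_entropy_via_sqrt: "binary_entropy ((1 - sqrt ((1 - 2 * a)\<^sup>2)) / 2) = binary_entropy a"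
proof (cases "a \<le> 1/2")
  case False
  then have "(1 - sqrt ((1 - 2 * a)\<^sup>2)) / 2 = 1 - a" by (simp add: field_simps)
  then show ?thesis by (simp only: binary_entropy_sym)
qed simp

lemma phi_bounds: "s \<in> {0..1/2} \<Longrightarrow> 0 \<le> phi s \<and> phi s \<le> 1/2"
  by (simp add: phi_def)

definition adder_bound :: "real \<Rightarrow> real \<Rightarrow> (real \<times> real) set" where
  "adder_bound u1 u2 = {(R1, R2). 0 \<le> R1 \<and> 0 \<le> R2 \<and>
     R1 \<le> 1/2 * binary_entropy (phi (2 * u1)) \<and>
     R2 \<le> 1/2 * binary_entropy (phi (2 * u2)) \<and>
     R1 + R2 \<le> binary_entropy ((1 - phi_conv (2 * u1) (2 * u2)) / 2)}"

text \<open>The witness is \<open>u\<^sub>i = E[a\<^sub>i (1 - a\<^sub>i)]\<close> with \<open>a\<^sub>i = P(X\<^sub>i = 0 | T)\<close>, so that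
  \<open>1 - 4 u\<^sub>i = E[(1 - 2 a\<^sub>i)\<^sup>2]\<close>.\<close>

lemma cl_rates_noisy_adder_subset:
  assumes finT: "finite (set_pmf pT)" and inp: "cl_inputs {0, 1} {0, 1} pT p1 p2"
  shows "\<exists>u1\<in>{0..1/4}. \<exists>u2\<in>{0..1/4}. cl_rates noisy_adder pT p1 p2 \<subseteq> adder_bound u1 u2"
proof -
  define a b where "a t = pmf (p1 t) 0" and "b t = pmf (p2 t) 0" for t
  define v w where "v = (\<integral>t. (1 - 2 * a t)\<^sup>2 \<partial>pT)" and "w = (\<integral>t. (1 - 2 * b t)\<^sup>2 \<partial>pT)"
  note [simp] = integrable_measure_pmf_finite[OF finT]
  have ab: "0 \<le> a t" "a t \<le> 1" "0 \<le> b t" "b t \<le> 1" for t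
    by (simp_all add: a_def b_def pmf_le_1)
  have sq: "(1 - 2 * x)\<^sup>2 \<in> {0..1}" if "0 \<le> x" "x \<le> 1" for x :: real
    using that by (auto simp: abs_square_le_1)
  have vw: "v \<in> {0..1}" "w \<in> {0..1}"
    using measure_pmf.integral_le_const[of pT "\<lambda>t. (1 - 2 * a t)\<^sup>2" 1]
      measure_pmf.integral_le_const[of pT "\<lambda>t. (1 - 2 * b t)\<^sup>2" 1] sq ab
    by (auto simp: v_def w_def)
  have ones: "pmf (p1 t) 1 = 1 - a t" "pmf (p2 t) 1 = 1 - b t" if "t \<in> set_pmf pT" for t
    using inp that sum_pmf_eq_1[of "{0, 1}" "p1 t"] sum_pmf_eq_1[of "{0, 1}" "p2 t"]
    by (auto simp: cl_inputs_def a_def b_def)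
  have H: "(\<integral>t. binary_entropy (c t) \<partial>pT) \<le> binary_entropy ((1 - sqrt (\<integral>t. (1 - 2 * c t)\<^sup>2 \<partial>pT)) / 2)"
    if "\<And>t. 0 \<le> c t \<and> c t \<le> 1" for c
    using measure_pmf_jensen_concave[OF finT concave_on_binary_entropy_sqrt, of "\<lambda>t. (1 - 2 * c t)\<^sup>2"] sq that
    by (simp only: binary_entropy_via_sqrt)
  have Ha: "(\<integral>t. binary_entropy (a t) \<partial>pT) \<le> binary_entropy ((1 - sqrt v) / 2)"
    and Hb: "(\<integral>t. binary_entropy (b t) \<partial>pT) \<le> binary_entropy ((1 - sqrt w) / 2)"
    unfolding v_def w_def by (rule H; simp add: ab)+
  define q0 q2 where "q0 = (\<integral>t. a t * b t \<partial>pT)" and "q2 = (\<integral>t. (1 - a t) * (1 - b t) \<partial>pT)"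
  \<comment> \<open>The mass at 1 is known to be complementary only for \<open>t\<close> in the
    support, hence equality almost everywhere.\<close>
  have q2: "(\<integral>t. pmf (p1 t) 1 * pmf (p2 t) 1 \<partial>pT) = q2"
    unfolding q2_def by (rule integral_cong_AE) (auto intro!: AE_pmfI simp: ones ones[unfolded One_nat_def])
  have q_bounds: "q0 \<in> {0..1}" "q2 \<in> {0..1}"
    unfolding q0_def q2_def using ab
    by (auto intro!: measure_pmf.integral_le_const integral_nonneg_AE mult_le_one AE_pmfI)
  have sumq: "q0 + q2 = (\<integral>t. a t * b t + (1 - a t) * (1 - b t) \<partial>pT)"
    unfolding q0_def q2_def by (rule Bochner_Integration.integral_add[symmetric]) simp_all
  \<comment> \<open>Centring the inputs:
    \<open>a b + (1 - a) (1 - b) = (1 + (1 - 2 a) (1 - 2 b)) / 2\<close>, which exposes the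
    correlation for Cauchy-Schwarz.\<close>
  have "(q0 + q2) / 2 = (\<integral>t. 1 / 4 + (1 - 2 * a t) * (1 - 2 * b t) / 4 \<partial>pT)"
    unfolding sumq Bochner_Integration.integral_divide_zero[symmetric]
    by (rule Bochner_Integration.integral_cong[OF refl]) (simp add: field_simps)
  also have "\<dots> = 1 / 4 + (\<integral>t. (1 - 2 * a t) * (1 - 2 * b t) \<partial>pT) / 4"
    by (subst Bochner_Integration.integral_add) simp_all
  also have "\<dots> \<le> 1 / 4 + sqrt (v * w) / 4"
    using measure_pmf_cauchy_schwarz[OF finT, of "\<lambda>t. 1 - 2 * a t" "\<lambda>t. 1 - 2 * b t"]
    by (simp add: v_def w_def)
  finally have q: "(q0 + q2) / 2 \<le> 1 / 4 + sqrt (v * w) / 4" .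
  have "v * w \<le> 1"
    using vw by (simp add: mult_le_one)
  then have vw1: "sqrt (v * w) \<le> 1" by simp
  have "(binary_entropy q0 + binary_entropy q2) / 2 \<le> binary_entropy ((q0 + q2) / 2)"
    using concave_onD[OF concave_on_binary_entropy, of "1/2" q0 q2] q_bounds by (simp add: field_simps)
  \<comment> \<open>As \<open>sqrt (v * w) \<le> 1\<close>, both arguments lie in
    \<open>[0,1/2]\<close>, where entropy increases.\<close>
  also have "\<dots> \<le> binary_entropy (1 / 4 + sqrt (v * w) / 4)"
    using q vw1 q_bounds by (intro binary_entropy_mono) (simp, simp, linarith)
  finally have S: "(binary_entropy q0 + binary_entropy q2) / 2 \<le> binary_entropy (1 / 4 + sqrt (v * w) / 4)" .
  define u1 u2 where "u1 = (1 - v) / 4" and "u2 = (1 - w) / 4"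
  have u: "u1 \<in> {0..1/4}" "u2 \<in> {0..1/4}"
    using vw by (auto simp: u1_def u2_def)
  have phi: "phi (2 * u1) = (1 - sqrt v) / 2" "phi (2 * u2) = (1 - sqrt w) / 2"
    using vw by (auto simp: phi_def u1_def u2_def field_simps)
  \<comment> \<open>Since \<open>1 - 4 * u1 = v\<close> and \<open>1 - 4 * u2 = w\<close>,
    \<open>phi_conv\<close> equals \<open>(1 - sqrt (v * w)) / 2\<close>.\<close>
  have conv: "(1 - phi_conv (2 * u1) (2 * u2)) / 2 = 1 / 4 + sqrt (v * w) / 4"
    unfolding phi_conv_def phi by (simp add: real_sqrt_mult field_simps)
  have "cl_rates noisy_adder pT p1 p2 \<subseteq> adder_bound u1 u2"
    unfolding cl_rates_noisy_adder[OF finT inp, folded a_def b_def, folded q0_def, unfolded q2]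
      adder_bound_def phi conv
    using Ha Hb S by force
  then show ?thesis
    using u by blast
qed

text \<open>The two values of \<open>T\<close> give complementary input probabilities, so entropy
  symmetry makes the individual rates constant in \<open>t\<close>. Exchanging those values
  exchanges \<open>q0\<close> and \<open>q2\<close>, which are therefore equal.\<close>

lemma cl_rates_symmetric_inputs:
  assumes inp: "cl_inputs {0, 1} {0, 1} (pmf_of_set {0, 1}) p1 p2"
    and p: "pmf (p1 0) 0 = phi (2 * u1)" "1 - pmf (p1 1) 0 = phi (2 * u1)"
      "pmf (p2 0) 0 = phi (2 * u2)" "1 - pmf (p2 1) 0 = phi (2 * u2)"
  shows "cl_rates noisy_adder (pmf_of_set {0, 1}) p1 p2 = adder_bound u1 u2"
proof -
  have E: "(\<integral>t. g t \<partial>pmf_of_set {0, 1 :: nat}) = (g 0 + g 1) / 2" for g :: "nat \<Rightarrow> real"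
    by (simp add: integral_pmf_of_set)
  have one: "pmf (p1 t) 1 = 1 - pmf (p1 t) 0" "pmf (p2 t) 1 = 1 - pmf (p2 t) 0" if "t \<in> {0, 1}" for t
    using inp that sum_pmf_eq_1[of "{0, 1}" "p1 t"] sum_pmf_eq_1[of "{0, 1}" "p2 t"]
    by (auto simp: cl_inputs_def)
  have p': "pmf (p1 1) 0 = 1 - phi (2 * u1)" "pmf (p2 1) 0 = 1 - phi (2 * u2)"
    using p by auto
  let ?q = "(1 - phi_conv (2 * u1) (2 * u2)) / 2"
  have q: "(phi (2 * u1) * phi (2 * u2) + (1 - phi (2 * u1)) * (1 - phi (2 * u2))) / 2 = ?q"
    "((1 - phi (2 * u1)) * (1 - phi (2 * u2)) + (1 - (1 - phi (2 * u1))) * (1 - (1 - phi (2 * u2)))) / 2 = ?q"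
    by (simp_all add: phi_conv_def field_simps)
  have avg: "(x + x) / 2 = x" for x :: real
    by simp
  show ?thesis
    unfolding adder_bound_def
    by (subst cl_rates_noisy_adder[OF _ inp], simp)
       (simp only: E one insertI1 insertI2 p p' q binary_entropy_sym avg)
qed

section \<open>Realising the symmetric inputs and closing the inclusions\<close>

lemma binary_kernel_exists:
  fixes a :: "'t \<Rightarrow> real"
  assumes "\<And>t. 0 \<le> a t \<and> a t \<le> 1"
  obtains k :: "'t \<Rightarrow> nat pmf" where "\<And>t. set_pmf (k t) \<subseteq> {0, 1}" "\<And>t. pmf (k t) 0 = a t"
proof
  \<comment> \<open>Success is sent to symbol 0, so the Bernoulli parameter is the probability of
    0.\<close>
  let ?k = "\<lambda>t. map_pmf (\<lambda>x. if x then 0 else 1 :: nat) (bernoulli_pmf (a t))"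
  show "set_pmf (?k t) \<subseteq> {0, 1}" for t by auto
  show "pmf (?k t) 0 = a t" for t
    using pmf_map_inj'[of "\<lambda>x. if x then 0 else 1 :: nat" "bernoulli_pmf (a t)" True] assms[of t]
    by (simp add: inj_def)
qed

lemma symmetric_inputs_exist:
  assumes "u1 \<in> {0..1/4}" "u2 \<in> {0..1/4}"
  obtains p1 p2 :: "nat \<Rightarrow> nat pmf" where "cl_inputs {0, 1} {0, 1} (pmf_of_set {0, 1}) p1 p2"
    "pmf (p1 0) 0 = phi (2 * u1)" "1 - pmf (p1 1) 0 = phi (2 * u1)"
    "pmf (p2 0) 0 = phi (2 * u2)" "1 - pmf (p2 1) 0 = phi (2 * u2)"
proof -
  \<comment> \<open>Kernels are total on the naturals, so every nonzero \<open>t\<close> receives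
    the value meant for \<open>t = 1\<close>.\<close>
  define a where "a u t = (if t = 0 then phi (2 * u) else 1 - phi (2 * u))" for u and t :: nat
  have *: "0 \<le> a u t \<and> a u t \<le> 1" if "u \<in> {0..1/4}" for u t
    using phi_bounds[of "2 * u"] that by (auto simp: a_def)
  obtain p1 :: "nat \<Rightarrow> nat pmf" where p1: "\<And>t. set_pmf (p1 t) \<subseteq> {0, 1}" "\<And>t. pmf (p1 t) 0 = a u1 t"
    using binary_kernel_exists[of "a u1", OF *[OF assms(1)]] by blast
  obtain p2 :: "nat \<Rightarrow> nat pmf" where p2: "\<And>t. set_pmf (p2 t) \<subseteq> {0, 1}" "\<And>t. pmf (p2 t) 0 = a u2 t"
    using binary_kernel_exists[of "a u2", OF *[OF assms(2)]] by blast
  show ?thesis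
    by (rule that[of p1 p2]) (use p1 p2 in \<open>auto simp: cl_inputs_def a_def\<close>)
qed

theorem mainTheorem4:
  shows "cover_leung {0, 1} {0, 1} {0, 1, 2, 3} noisy_adder =
      (\<Union>u1\<in>{0..1/4}. \<Union>u2\<in>{0..1/4}.
         {(R1, R2). 0 \<le> R1 \<and> 0 \<le> R2 \<and>
            R1 \<le> 1/2 * binary_entropy (phi (2 * u1)) \<and>
            R2 \<le> 1/2 * binary_entropy (phi (2 * u2)) \<and>
            R1 + R2 \<le> binary_entropy ((1 - phi_conv (2 * u1) (2 * u2)) / 2)})
    \<and> cover_leung {0, 1} {0, 1} {0, 1, 2, 3} noisy_adder =
      \<Union> {cl_rates noisy_adder (pmf_of_set {0, 1}) p1 p2 | p1 p2.
           cl_inputs {0, 1} {0, 1} (pmf_of_set {0, 1}) p1 p2}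
    \<and> cover_leung {0, 1} {0, 1} {0, 1, 2, 3} noisy_adder =
      (\<Union>u1\<in>{0..1/4}. \<Union>u2\<in>{0..1/4}.
         \<Union> {cl_rates noisy_adder (pmf_of_set {0, 1}) p1 p2 | p1 p2.
              cl_inputs {0, 1} {0, 1} (pmf_of_set {0, 1}) p1 p2 \<and>
              pmf (p1 0) 0 = phi (2 * u1) \<and> 1 - pmf (p1 1) 0 = phi (2 * u1) \<and>
              pmf (p2 0) 0 = phi (2 * u2) \<and> 1 - pmf (p2 1) 0 = phi (2 * u2)})"
    (is "?CL = ?F \<and> _ = ?U \<and> _ = ?S")
proof -
  have F: "?F = (\<Union>u1\<in>{0..1/4}. \<Union>u2\<in>{0..1/4}. adder_bound u1 u2)"
    by (simp only: adder_bound_def)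
  \<comment> \<open>All three equalities follow from the cycle \<open>?CL \<subseteq> ?F \<subseteq>
    ?S \<subseteq> ?U \<subseteq> ?CL\<close>.\<close>
  have CF: "?CL \<subseteq> ?F"
  proof
    fix R assume "R \<in> ?CL"
    then obtain pT p1 p2 where R: "R \<in> cl_rates noisy_adder pT p1 p2"
      and p: "finite (set_pmf pT)" "cl_inputs {0, 1} {0, 1} pT p1 p2"
      unfolding cover_leung_def by (elim UnionE CollectE exE conjE) simp
    from cl_rates_noisy_adder_subset[OF p] R show "R \<in> ?F"
      unfolding F by blast
  qed
  have FS: "?F \<subseteq> ?S"
  proof
    fix R assume "R \<in> ?F"
    then obtain u1 u2 where u: "u1 \<in> {0..1/4}" "u2 \<in> {0..1/4}" and R: "R \<in> adder_bound u1 u2"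
      unfolding F by (elim UN_E)
    obtain p1 p2 :: "nat \<Rightarrow> nat pmf" where p: "cl_inputs {0, 1} {0, 1} (pmf_of_set {0, 1}) p1 p2"
      "pmf (p1 0) 0 = phi (2 * u1)" "1 - pmf (p1 1) 0 = phi (2 * u1)"
      "pmf (p2 0) 0 = phi (2 * u2)" "1 - pmf (p2 1) 0 = phi (2 * u2)"
      using symmetric_inputs_exist[OF u] .
    from R have "R \<in> cl_rates noisy_adder (pmf_of_set {0, 1}) p1 p2"
      by (simp only: cl_rates_symmetric_inputs[OF p])
    with p have "R \<in> \<Union> {cl_rates noisy_adder (pmf_of_set {0, 1}) p1 p2 | p1 p2.
              cl_inputs {0, 1} {0, 1} (pmf_of_set {0, 1}) p1 p2 \<and>
              pmf (p1 0) 0 = phi (2 * u1) \<and> 1 - pmf (p1 1) 0 = phi (2 * u1) \<and>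
              pmf (p2 0) 0 = phi (2 * u2) \<and> 1 - pmf (p2 1) 0 = phi (2 * u2)}"
      by (intro UnionI[of "cl_rates noisy_adder (pmf_of_set {0, 1}) p1 p2"] CollectI exI conjI)
         (rule refl | assumption)+
    then show "R \<in> ?S"
      by (rule UN_I[OF u(1) UN_I[OF u(2)]])
  qed
  have SU: "?S \<subseteq> ?U"
    by (intro UN_least Union_mono) blast
  \<comment> \<open>A uniform binary \<open>T\<close> has two values, within the cardinality bound
    \<open>min 5 6\<close>.\<close>
  have UC: "?U \<subseteq> ?CL"
    unfolding cover_leung_def
  proof (intro Union_mono subsetI, elim CollectE exE conjE)
    fix A p1 p2
    assume "A = cl_rates noisy_adder (pmf_of_set {0, 1}) p1 p2"
      and "cl_inputs {0, 1} {0, 1} (pmf_of_set {0, 1}) p1 p2"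
    then show "A \<in> {cl_rates noisy_adder pT p1 p2 | pT p1 p2. finite (set_pmf pT)
        \<and> card (set_pmf pT) \<le> min (card {0 :: nat, 1} * card {0 :: nat, 1} + 1) (card {0 :: nat, 1, 2, 3} + 2)
        \<and> cl_inputs {0, 1} {0, 1} pT p1 p2}"
      by (intro CollectI exI[of _ "pmf_of_set {0, 1}"] exI[of _ p1] exI[of _ p2]) simp
  qed
  have "?CL = ?F"
    by (rule subset_antisym[OF CF subset_trans[OF FS subset_trans[OF SU UC]]])
  moreover have "?CL = ?U"
    by (rule subset_antisym[OF subset_trans[OF CF subset_trans[OF FS SU]] UC])
  moreover have "?CL = ?S"
    by (rule subset_antisym[OF subset_trans[OF CF FS] subset_trans[OF SU UC]])
  ultimately show ?thesis
    by (intro conjI)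
qed

end
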